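(* Let $S\subset\mathbb{N}^p$ be an affine semigroup minimally generated by $E\sqcup A$ with $E=\{n_1,\ldots,n_t\}$, where $t$ is the number of extremal rays $\tau_1,\ldots,\tau_t$ of $\mathcal{C}_S$ and $n_i=\mathrm{mult}_i(S)$ for each $i\in\{1,\ldots,t\}$, and such that for any $m\in A$, $m-n_k\in\mathcal{C}_S$ for some $n_k\in E$. If the set $S_k$ is a semigroup, then $S$ is a MED-semigroup.
   Context: $\mathbb{N}$ contains $0$, and $p\ge 1$. An affine semigroup $S\subseteq\mathbb{N}^p$ is a finitely generated submonoid of $(\mathbb{N}^p,+)$ (containing $0$). $\mathcal{C}_S$ is the set of non-negative rational linear combinations of elements of $S$, intersected with $\mathbb{N}^p$; its extremal rays are the one-dimensional faces of the rational cone generated by $S$ (intersected with $\mathbb{N}^p$). The $i$-multiplicity $\mathrm{mult}_i(S)$ is the minimum non-zero element of $\tau_i\cap S$ for the componentwise partial order on $\mathbb{N}^p$. For each $i\in\{1,\ldots,t\}$, $S_i=\{x\in\mathcal{C}_S\mid x+n_i\in S\}$. The Apery set of $S$ with respect to $m\in S$ is $\mathrm{Ap}(S,m)=\{s\in S\mid s-m\notin S\}$. With $S$ minimally generated by $E\sqcup A$ as in the claim, $S$ is a maximal embedding dimension affine semigroup (MED-semigroup) if $\bigcap_{i=1}^t\mathrm{Ap}(S,n_i)=A\sqcup\{0\}$. *)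

theory Defs
  imports "HOL-Analysis.Analysis"
begin

text \<open>
  The monoid of \<open>p\<close>-tuples of natural numbers is the type \<^typ>\<open>nat ^ 'p\<close>, where \<open>p\<close> is the
  cardinality of the finite index type; its order is componentwise. Subtraction on this type
  is truncated, so ``\<open>s - m\<close> lies in \<open>X\<close>'' (a difference of integer vectors, with \<open>X\<close> a set of
  natural vectors) is always written as ``\<open>s = u + m\<close> for some \<open>u\<close> in \<open>X\<close>''.
\<close>

definition add_closed :: "('a::plus) set \<Rightarrow> bool" where
  "add_closed X \<longleftrightarrow> (\<forall>x\<in>X. \<forall>y\<in>X. x + y \<in> X)"

definition add_submonoid :: "('a::monoid_add) set \<Rightarrow> bool" where
  "add_submonoid X \<longleftrightarrow> 0 \<in> X \<and> add_closed X"

definition affine_semigroup :: "(nat ^ 'p) set \<Rightarrow> bool" where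
  "affine_semigroup S \<longleftrightarrow> (\<exists>G. finite G \<and> S = add_submonoid hull G)"

definition minimally_generated_by :: "('a::monoid_add) set \<Rightarrow> 'a set \<Rightarrow> bool" where
  "minimally_generated_by S G \<longleftrightarrow>
     S = add_submonoid hull G \<and> (\<forall>G'. G' \<subset> G \<longrightarrow> add_submonoid hull G' \<noteq> S)"

definition rat_vec :: "nat ^ 'p \<Rightarrow> rat ^ 'p" where
  "rat_vec x = (\<chi> j. of_nat (x $ j))"

definition rat_cone :: "(nat ^ 'p) set \<Rightarrow> (rat ^ 'p) set" where
  "rat_cone S = {v. \<exists>T c. finite T \<and> T \<subseteq> S \<and> (\<forall>x\<in>T. 0 \<le> c x) \<and>
                          v = (\<Sum>x\<in>T. c x *s rat_vec x)}"

definition int_cone :: "(nat ^ 'p) set \<Rightarrow> (nat ^ 'p) set" where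
  "int_cone S = {x. rat_vec x \<in> rat_cone S}"

text \<open>
  Faces of a rational cone are its intersections with supporting hyperplanes through the origin;
  the zero functional gives the cone itself. (The library's \<^term>\<open>(face_of)\<close> is for real
  vector spaces only.)
\<close>

definition cone_face :: "(rat ^ 'p) set \<Rightarrow> (rat ^ 'p) set \<Rightarrow> bool" where
  "cone_face F C \<longleftrightarrow>
     (\<exists>l :: rat ^ 'p. (\<forall>x\<in>C. 0 \<le> (\<Sum>j\<in>UNIV. l $ j * x $ j)) \<and>
                      F = {x\<in>C. (\<Sum>j\<in>UNIV. l $ j * x $ j) = 0})"

definition extremal_rays :: "(nat ^ 'p) set \<Rightarrow> (nat ^ 'p) set set" where
  "extremal_rays S = {{x. rat_vec x \<in> F} |F. cone_face F (rat_cone S) \<and> vec.dim F = 1}"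

text \<open>
  On an extremal ray the componentwise order is total, so the minimal non-zero element of \<open>S\<close>
  on it is a least element.
\<close>

definition ray_mult :: "(nat ^ 'p) set \<Rightarrow> (nat ^ 'p) set \<Rightarrow> nat ^ 'p" where
  "ray_mult S \<tau> = (LEAST x. x \<in> \<tau> \<inter> S \<and> x \<noteq> 0)"

definition shifted_cone_part :: "(nat ^ 'p) set \<Rightarrow> nat ^ 'p \<Rightarrow> (nat ^ 'p) set" where
  "shifted_cone_part S m = {x \<in> int_cone S. x + m \<in> S}"

definition apery :: "(nat ^ 'p) set \<Rightarrow> nat ^ 'p \<Rightarrow> (nat ^ 'p) set" where
  "apery S m = {s \<in> S. \<not> (\<exists>u\<in>S. s = u + m)}"

text \<open>
  The bijection makes \<open>t\<close> the number of extremal rays and \<open>\<tau> 1, \<dots>, \<tau> t\<close> an enumeration of them.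
\<close>

definition extremal_presentation ::
  "(nat ^ 'p) set \<Rightarrow> nat \<Rightarrow> (nat \<Rightarrow> (nat ^ 'p) set) \<Rightarrow> (nat \<Rightarrow> nat ^ 'p) \<Rightarrow> (nat ^ 'p) set \<Rightarrow> bool" where
  "extremal_presentation S t \<tau> n A \<longleftrightarrow>
     affine_semigroup S \<and>
     bij_betw \<tau> {1..t} (extremal_rays S) \<and>
     (\<forall>i\<in>{1..t}. n i = ray_mult S (\<tau> i)) \<and>
     n ` {1..t} \<inter> A = {} \<and>
     minimally_generated_by S (n ` {1..t} \<union> A)"

text \<open>
  Intersecting with \<open>S\<close> only matters for \<open>t = 0\<close>, that is for the zero semigroup, where the empty
  intersection of subsets of \<open>S\<close> has to be \<open>S\<close>.
\<close>

definition MED_semigroup ::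
  "(nat ^ 'p) set \<Rightarrow> nat \<Rightarrow> (nat \<Rightarrow> (nat ^ 'p) set) \<Rightarrow> (nat \<Rightarrow> nat ^ 'p) \<Rightarrow> (nat ^ 'p) set \<Rightarrow> bool" where
  "MED_semigroup S t \<tau> n A \<longleftrightarrow>
     extremal_presentation S t \<tau> n A \<and>
     0 \<notin> A \<and>
     S \<inter> (\<Inter>i\<in>{1..t}. apery S (n i)) = A \<union> {0}"

end

theory Submission
  imports Defs
begin

text \<open>
  An element of \<open>S\<close> lying in every Apery set is a sum of generators from \<open>A\<close> only. Two such
  generators are \<open>x + n\<^sub>k\<close> and \<open>y + n\<^sub>k\<close> with \<open>x\<close> and \<open>y\<close> in \<open>S\<^sub>k\<close>, and since \<open>x + y\<close> is again in
  \<open>S\<^sub>k\<close>, their sum \<open>(x + y + n\<^sub>k) + n\<^sub>k\<close> is an element of \<open>S\<close> shifted by \<open>n\<^sub>k\<close>; so at most one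
  generator occurs. The reverse inclusion uses only that the generating set is minimal.
\<close>

lemma add_submonoid_hull: "add_submonoid (add_submonoid hull G)"
  by (rule hull_in) (auto simp: add_submonoid_def add_closed_def)

lemma zero_in_add_submonoid_hull: "0 \<in> add_submonoid hull G"
  using add_submonoid_hull[of G] by (simp add: add_submonoid_def)

lemma add_in_add_submonoid_hull:
  "x \<in> add_submonoid hull G \<Longrightarrow> y \<in> add_submonoid hull G \<Longrightarrow> x + y \<in> add_submonoid hull G"
  using add_submonoid_hull[of G] by (simp add: add_submonoid_def add_closed_def)

text \<open>The hull elements satisfying \<open>P\<close> form a submonoid containing
  \<open>G\<close>, so by minimality of the hull they are all of it.\<close>

lemma add_submonoid_hull_induct [consumes 1, case_names zero generator add]:
  assumes "x \<in> add_submonoid hull G"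
    and "P 0"
    and "\<And>g. g \<in> G \<Longrightarrow> P g"
    and "\<And>x y. x \<in> add_submonoid hull G \<Longrightarrow> y \<in> add_submonoid hull G \<Longrightarrow> P x \<Longrightarrow> P y \<Longrightarrow> P (x + y)"
  shows "P x"
proof -
  let ?H = "{x \<in> add_submonoid hull G. P x}"
  have "add_submonoid ?H"
    using assms(2,4)
    by (auto simp: add_submonoid_def add_closed_def zero_in_add_submonoid_hull
        intro: add_in_add_submonoid_hull)
  moreover have "G \<subseteq> ?H"
    using assms(3) by (auto intro: hull_inc)
  ultimately have "add_submonoid hull G \<subseteq> ?H"
    by (intro hull_minimal)
  with assms(1) show ?thesis
    by blast
qed

text \<open>Peeling off one generator at a time takes the place of an explicit representation as a
  finite sum of generators.\<close>

lemma add_submonoid_hull_split_generator: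
  assumes "x \<in> add_submonoid hull G" "x \<noteq> 0"
  obtains g u where "g \<in> G" "u \<in> add_submonoid hull G" "x = g + u"
proof -
  \<comment> \<open>Allowing \<open>0\<close> lets the induction pass through sums: the generator
    comes from the left summand, or from the right one if the left is \<open>0\<close>.\<close>
  from assms(1) have "x = 0 \<or> (\<exists>g\<in>G. \<exists>u\<in>add_submonoid hull G. x = g + u)"
  proof (induction rule: add_submonoid_hull_induct)
    case (generator g)
    then show ?case
      using zero_in_add_submonoid_hull add_0_right by metis
  next
    case (add x y)
    then show ?case
      using add_in_add_submonoid_hull add.assoc add_0_left by metis
  qed simp
  with assms(2) that show thesis
    by blast
qed

text \<open>A sum of generators either avoids \<open>m\<close> or, by commutativity, can be
  rearranged to start with \<open>m\<close>.\<close>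

lemma add_submonoid_hull_remove_generator:
  fixes x m :: "'a::comm_monoid_add"
  assumes "x \<in> add_submonoid hull G"
  shows "x \<in> add_submonoid hull (G - {m}) \<or> (\<exists>v. x = m + v)"
  using assms
proof (induction rule: add_submonoid_hull_induct)
  case zero
  then show ?case
    by (simp add: zero_in_add_submonoid_hull)
next
  case (generator g)
  then show ?case
    by (cases "g = m") (auto intro: hull_inc add_0_right[symmetric])
next
  case (add x y)
  then show ?case
    using add_in_add_submonoid_hull add.assoc add.commute by metis
qed

text \<open>Otherwise the proper subset \<open>G - {m}\<close> would already generate
  \<open>S\<close>.\<close>

lemma minimal_generator_notin_hull:
  assumes "minimally_generated_by S G" "m \<in> G"
  shows "m \<notin> add_submonoid hull (G - {m})"
proof
  assume "m \<in> add_submonoid hull (G - {m})"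
  then have "add_submonoid hull (G - {m}) = S"
    using assms hull_redundant[of m add_submonoid "G - {m}"]
    by (simp add: minimally_generated_by_def insert_absorb)
  moreover have "G - {m} \<subset> G"
    using assms(2) by blast
  ultimately show False
    using assms(1) unfolding minimally_generated_by_def by blast
qed

lemma minimal_generator_nonzero:
  "minimally_generated_by S G \<Longrightarrow> m \<in> G \<Longrightarrow> m \<noteq> 0"
  using minimal_generator_notin_hull zero_in_add_submonoid_hull by blast

text \<open>This puts \<open>A\<close> into every Apery set. If \<open>u\<close> can be generated
  without \<open>m\<close>, so can \<open>u + g\<close>, which contradicts minimality when it equals
  \<open>m\<close>; otherwise \<open>m\<close> is a summand of \<open>u\<close>.\<close>

lemma minimal_generator_neq_add_generator:
  fixes S G :: "(nat ^ 'p) set"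
  assumes min: "minimally_generated_by S G"
    and "m \<in> G" "g \<in> G" "g \<noteq> m" "u \<in> S"
  shows "m \<noteq> u + g"
proof
  assume m: "m = u + g"
  from min \<open>u \<in> S\<close> have "u \<in> add_submonoid hull G"
    by (simp add: minimally_generated_by_def)
  then consider "u \<in> add_submonoid hull (G - {m})" | v where "u = m + v"
    using add_submonoid_hull_remove_generator by blast
  then show False
  proof cases
    case 1
    moreover have "g \<in> add_submonoid hull (G - {m})"
      using assms by (auto intro: hull_inc)
    ultimately show False
      using minimal_generator_notin_hull[OF min \<open>m \<in> G\<close>] m add_in_add_submonoid_hull by metis
  next
    case 2
    \<comment> \<open>Here \<open>m = m + v + g\<close>; cancelling \<open>m\<close> leaves a zero
      sum of natural coordinates, so both \<open>v\<close> and \<open>g\<close> vanish.\<close>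
    with m have "g = 0"
      by (simp add: vec_eq_iff)
    with minimal_generator_nonzero[OF min \<open>g \<in> G\<close>] show False
      by blast
  qed
qed

theorem proposition28:
  fixes S A :: "(nat ^ 'p) set"
    and t k :: nat
    and \<tau> :: "nat \<Rightarrow> (nat ^ 'p) set"
    and n :: "nat \<Rightarrow> nat ^ 'p"
  assumes "extremal_presentation S t \<tau> n A"
    and "k \<in> {1..t}"
    and "\<forall>m\<in>A. \<exists>x\<in>int_cone S. m = x + n k"
    and "add_closed (shifted_cone_part S (n k))"
  shows "MED_semigroup S t \<tau> n A"
proof -
  define G where "G = n ` {1..t} \<union> A"
  have min: "minimally_generated_by S G" and disj: "n ` {1..t} \<inter> A = {}"
    using assms(1) by (auto simp: extremal_presentation_def G_def)
  then have S: "S = add_submonoid hull G"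
    by (simp add: minimally_generated_by_def)
  have A_sub: "A \<subseteq> S"
    by (auto simp: S G_def intro: hull_inc)
  have "0 \<notin> A"
    using minimal_generator_nonzero[OF min] by (auto simp: G_def)
  moreover have "0 \<in> apery S (n i)" if "i \<in> {1..t}" for i
  proof -
    have "n i \<noteq> 0"
      using minimal_generator_nonzero[OF min] that by (auto simp: G_def)
    then show ?thesis
      by (auto simp: apery_def S zero_in_add_submonoid_hull vec_eq_iff)
  qed
  moreover have "m \<in> apery S (n i)" if "i \<in> {1..t}" "m \<in> A" for i m
  proof -
    have "m \<in> G" "n i \<in> G" "n i \<noteq> m"
      using that disj unfolding G_def by blast+
    with minimal_generator_neq_add_generator[OF min] A_sub that(2) show ?thesis
      by (auto simp: apery_def)
  qed
  moreover have "s \<in> A"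
    if "s \<in> S" "s \<noteq> 0" and apery: "\<And>i. i \<in> {1..t} \<Longrightarrow> s \<in> apery S (n i)" for s
  proof (rule ccontr)
    assume "s \<notin> A"
    have not_shift: "s \<noteq> u + n i" if "i \<in> {1..t}" "u \<in> S" for i u
      using apery[OF that(1)] that(2) by (auto simp: apery_def)
    \<comment> \<open>A generator outside \<open>A\<close> is some \<open>n i\<close>, and splitting
      it off \<open>s\<close> within \<open>S\<close> would violate membership in
      \<open>apery S (n i)\<close>.\<close>
    have in_A: "g \<in> A" if "g \<in> G" "u \<in> S" "s = u + g" for g u
      using that not_shift unfolding G_def by blast
    obtain a u where a: "a \<in> G" "u \<in> S" "s = a + u"
      using add_submonoid_hull_split_generator \<open>s \<in> S\<close> \<open>s \<noteq> 0\<close> unfolding S by metis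
    then have "a \<in> A"
      using in_A by (simp add: add.commute)
    with \<open>s \<notin> A\<close> a(3) have "u \<noteq> 0"
      by auto
    then obtain b w where b: "b \<in> G" "w \<in> S" "u = b + w"
      using add_submonoid_hull_split_generator a(2) unfolding S by metis
    \<comment> \<open>This is what remains of \<open>s\<close> once \<open>b\<close> is split off,
      so \<open>in_A\<close> applies to \<open>b\<close> too.\<close>
    have "a + w \<in> S"
      using hull_inc[OF a(1)] b(2) unfolding S by (rule add_in_add_submonoid_hull)
    then have "b \<in> A"
      using in_A b(1,3) a(3) by (simp add: ac_simps)
    obtain x y where xy: "x \<in> int_cone S" "a = x + n k" "y \<in> int_cone S" "b = y + n k"
      using assms(3) \<open>a \<in> A\<close> \<open>b \<in> A\<close> by blast
    then have "x \<in> shifted_cone_part S (n k)" "y \<in> shifted_cone_part S (n k)"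
      using A_sub \<open>a \<in> A\<close> \<open>b \<in> A\<close> by (auto simp: shifted_cone_part_def)
    then have "x + y + n k \<in> S"
      using assms(4) by (auto simp: add_closed_def shifted_cone_part_def)
    \<comment> \<open>Carrying the remainder \<open>w\<close> along means that two generators
      suffice, however many summands \<open>s\<close> has.\<close>
    then have "x + y + n k + w \<in> S"
      using b(2) unfolding S by (rule add_in_add_submonoid_hull)
    moreover have "s = (x + y + n k + w) + n k"
      using a(3) b(3) xy by (simp add: ac_simps)
    ultimately show False
      using not_shift assms(2) by blast
  qed
  ultimately have "S \<inter> (\<Inter>i\<in>{1..t}. apery S (n i)) = A \<union> {0}"
    using A_sub zero_in_add_submonoid_hull[of G] unfolding S[symmetric] by blast
  with assms(1) \<open>0 \<notin> A\<close> show ?thesis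
    by (simp add: MED_semigroup_def)
qed

end
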